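(* Let $q$ be a prime power, let $r$ be a positive integer, and let $\mathcal Q$ be an $[[n,\kappa,\delta;c]]_q$ CSS-like EAQLRC with locality $r$ (pure or impure), i.e. $\mathcal Q=\mathcal Q(\mathcal C_X,\mathcal C_Z)$ for linear codes $\mathcal C_X,\mathcal C_Z\subseteq\mathbb F_q^n$ satisfying the paired support condition with parameter $r$. Then $$2\delta\le n+c-\kappa-2\left\lceil\frac{\kappa}{r}\right\rceil+4.$$
   Context: Notation. $[m]=\{1,\dots,m\}$. An $[n,k,d]_q$ linear code is a $k$-dimensional subspace of $\mathbb F_q^n$ with minimum distance $d$; $\mathcal C^\perp$ is the Euclidean dual; $\mathrm{supp}(\mathbf u)=\{i:u_i\neq0\}$; for a set $S\subseteq\mathbb F_q^n$ containing a nonzero vector, $\mathrm{wt}(S)$ is the minimum Hamming weight of its nonzero vectors. Paired support condition with parameter $r$ for linear codes $\mathcal C_X,\mathcal C_Z\subseteq\mathbb F_q^n$: for every $i\in[n]$ there exist $\mathbf h_i^X\in\mathcal C_X^\perp$ and $\mathbf h_i^Z\in\mathcal C_Z^\perp$ such that $i\in\mathrm{supp}(\mathbf h_i^X)\cap\mathrm{supp}(\mathbf h_i^Z)$ and $|\mathrm{supp}(\mathbf h_i^X)\cup\mathrm{supp}(\mathbf h_i^Z)|\le r+1$. CSS-like EAQLRC with locality $r$. This is the entanglement-assisted quantum code $\mathcal Q(\mathcal C_X,\mathcal C_Z)$ given by the EA-CSS construction from an $[n,k_X,d_X]_q$ code $\mathcal C_X$ and an $[n,k_Z,d_Z]_q$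 code $\mathcal C_Z$ satisfying the paired support condition with parameter $r$. Its parameters $[[n,\kappa,\delta;c]]_q$ ($n$ transmitted qudits, $\kappa$ logical qudits, minimum distance $\delta$, $c$ maximally entangled pairs) are $$c=n-k_X-\dim(\mathcal C_X^\perp\cap\mathcal C_Z)=n-k_Z-\dim(\mathcal C_X\cap\mathcal C_Z^\perp),\qquad\kappa=k_X+k_Z-n+c,$$ and $\delta=\min\{d_X,d_Z\}$ if $\mathcal C_X\subseteq\mathcal C_Z^\perp$, and otherwise $\delta=\min\{\mathrm{wt}(\mathcal C_X\setminus(\mathcal C_X\cap\mathcal C_Z^\perp)),\ \mathrm{wt}(\mathcal C_Z\setminus(\mathcal C_X^\perp\cap\mathcal C_Z))\}$. (The code is called pure if $\delta=\min\{d_X,d_Z\}$ and impure otherwise.) For completeness, the quantum code itself: with $q=p^m$, qudit basis $\{|x\rangle:x\in\mathbb F_q\}$, $X(a)|x\rangle=|x+a\rangle$, $Z(b)|x\rangle=e^{2\pi i\,{\rm tr}(bx)/p}|x\rangle$ (${\rm tr}:\mathbb F_q\to\mathbb F_p$ the trace), tensor products $X_A(\mathbf a),Z_A(\mathbf b)$ on a register $A$, parity-check matrices $\mathbf H_X,\mathbf H_Z$ of $\mathcal C_X,\mathcal C_Z$, and a rank factorization $-\mathbf H_X\mathbf H_Z^\top=\mathbf F_X\mathbf F_Z^\top$ where $\mathbf F_X,\mathbf F_Z$ have $c=\mathrm{rank}(\mathbf H_X\mathbf H_Z^\top)$ columns, $\mathcal Q(\mathcal C_X,\mathcal C_Z)$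 is the subspace of $(\mathbb C^q)^{\otimes n}\otimes(\mathbb C^q)^{\otimes c}$ (transmitted register $Q$, noiseless receiver register $B$) fixed by all operators $X_Q(\mathbf u\mathbf H_X)Z_Q(\mathbf v\mathbf H_Z)\otimes X_B(\mathbf u\mathbf F_X)Z_B(\mathbf v\mathbf F_Z)$, $\mathbf u\in\mathbb F_q^{n-k_X}$, $\mathbf v\in\mathbb F_q^{n-k_Z}$. *)

theory Defs
  imports
    Complex_Main
    "HOL-Library.Cardinality"
    "HOL-Library.Extended_Nat"
    "Jordan_Normal_Form.Matrix_Kernel"
    "Jordan_Normal_Form.DL_Rank"
begin

section \<open>Linear codes\<close>

text \<open>The field with \<open>q\<close> elements is a type \<open>'a :: {field, finite}\<close> with \<open>q = CARD('a)\<close>, and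
  words of length \<open>n\<close> are the elements of \<open>carrier_vec n\<close>, with coordinates \<open>0, \<dots>, n - 1\<close>.\<close>

definition linear_code :: "nat \<Rightarrow> 'a::field vec set \<Rightarrow> bool" where
  "linear_code n C \<longleftrightarrow> subspace class_ring C (module_vec TYPE('a) n)"

definition code_dim :: "nat \<Rightarrow> 'a::field vec set \<Rightarrow> nat" where
  "code_dim n C = vectorspace.dim class_ring ((module_vec TYPE('a) n)\<lparr>carrier := C\<rparr>)"

definition dual_code :: "nat \<Rightarrow> 'a::field vec set \<Rightarrow> 'a vec set" where
  "dual_code n C = {x \<in> carrier_vec n. \<forall>y\<in>C. x \<bullet> y = 0}"

definition supp :: "'a::zero vec \<Rightarrow> nat set" where
  "supp u = {i. i < dim_vec u \<and> u $ i \<noteq> 0}"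

text \<open>The least Hamming weight of a nonzero word of \<open>S\<close>. It is \<open>\<infinity>\<close> if there is no such word;
  for a linear code it is the minimum distance.\<close>

definition min_wt :: "'a::zero vec set \<Rightarrow> enat" where
  "min_wt S = (INF u \<in> {u \<in> S. u \<noteq> 0\<^sub>v (dim_vec u)}. enat (card (supp u)))"

definition paired_support :: "nat \<Rightarrow> nat \<Rightarrow> 'a::field vec set \<Rightarrow> 'a vec set \<Rightarrow> bool" where
  "paired_support n r C\<^sub>X C\<^sub>Z \<longleftrightarrow>
     (\<forall>i<n. \<exists>h\<^sub>X \<in> dual_code n C\<^sub>X. \<exists>h\<^sub>Z \<in> dual_code n C\<^sub>Z.
        i \<in> supp h\<^sub>X \<inter> supp h\<^sub>Z \<and> card (supp h\<^sub>X \<union> supp h\<^sub>Z) \<le> r + 1)"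


section \<open>The entanglement-assisted quantum code\<close>

text \<open>The field trace onto the prime field, the sum of the conjugates \<open>x ^ (p ^ i)\<close> for
  \<open>q = p ^ m\<close> and \<open>i < m\<close>.\<close>

definition prime_trace :: "'a::{field,finite} \<Rightarrow> 'a" where
  "prime_trace x = (\<Sum>i < (THE m. CARD('a) = CHAR('a) ^ m). x ^ (CHAR('a) ^ i))"

text \<open>The additive character \<open>x \<mapsto> exp (2 \<pi> \<i> tr(x) / p)\<close>, with \<open>tr(x)\<close> represented by an integer
  in \<open>{0..<p}\<close>.\<close>

definition add_char :: "'a::{field,finite} \<Rightarrow> complex" where
  "add_char x =
     exp (2 * of_real pi * \<i> * of_nat (THE t. t < CHAR('a) \<and> of_nat t = prime_trace x)
          / of_nat CHAR('a))"

text \<open>A vector of the \<open>N\<close>-fold tensor power of the \<open>q\<close>-dimensional complex space is given by its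
  coefficients with respect to the basis \<open>|x\<rangle>\<close>, \<open>x \<in> carrier_vec N\<close>; as a function on all of
  \<open>'a vec\<close> it vanishes off \<open>carrier_vec N\<close>.\<close>

definition qudit_space :: "nat \<Rightarrow> ('a vec \<Rightarrow> complex) set" where
  "qudit_space N = {\<psi>. \<forall>x. x \<notin> carrier_vec N \<longrightarrow> \<psi> x = 0}"

text \<open>\<open>X(a) |x\<rangle> = |x + a\<rangle>\<close> and \<open>Z(b) |x\<rangle> = (\<Prod>i<N. add_char (b\<^sub>i x\<^sub>i)) |x\<rangle>\<close>, in coefficients.\<close>

definition X_op :: "nat \<Rightarrow> 'a::{field,finite} vec \<Rightarrow> ('a vec \<Rightarrow> complex) \<Rightarrow> 'a vec \<Rightarrow> complex" where
  "X_op N a \<psi> = (\<lambda>x. if x \<in> carrier_vec N then \<psi> (x - a) else 0)"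

definition Z_op :: "nat \<Rightarrow> 'a::{field,finite} vec \<Rightarrow> ('a vec \<Rightarrow> complex) \<Rightarrow> 'a vec \<Rightarrow> complex" where
  "Z_op N b \<psi> = (\<lambda>x. if x \<in> carrier_vec N then (\<Prod>i<N. add_char (b $ i * x $ i)) * \<psi> x else 0)"

text \<open>Since \<open>H\<close> has \<open>n - dim C\<close> rows, its rows form a basis of the dual code.\<close>

definition parity_check :: "nat \<Rightarrow> 'a::field vec set \<Rightarrow> 'a mat \<Rightarrow> bool" where
  "parity_check n C H \<longleftrightarrow> H \<in> carrier_mat (n - code_dim n C) n \<and> mat_kernel H = C"

text \<open>The space stabilized by all \<open>X\<^sub>Q(u H\<^sub>X) Z\<^sub>Q(v H\<^sub>Z) \<otimes> X\<^sub>B(u F\<^sub>X) Z\<^sub>B(v F\<^sub>Z)\<close>. The registers \<open>Q\<close> and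
  \<open>B\<close> are the first \<open>n\<close> and the last \<open>c\<close> qudits, so a tensor product of two operators of the same
  kind is the operator of the concatenated vector; a row vector \<open>u H\<close> is written \<open>H\<^sup>T u\<close>.\<close>

definition stabilized_space ::
  "nat \<Rightarrow> nat \<Rightarrow> 'a::{field,finite} mat \<Rightarrow> 'a mat \<Rightarrow> 'a mat \<Rightarrow> 'a mat \<Rightarrow> ('a vec \<Rightarrow> complex) set" where
  "stabilized_space n c H\<^sub>X H\<^sub>Z F\<^sub>X F\<^sub>Z =
     {\<psi> \<in> qudit_space (n + c).
        \<forall>u \<in> carrier_vec (dim_row H\<^sub>X). \<forall>v \<in> carrier_vec (dim_row H\<^sub>Z).
          X_op (n + c) ((transpose_mat H\<^sub>X *\<^sub>v u) @\<^sub>v (transpose_mat F\<^sub>X *\<^sub>v u))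
            (Z_op (n + c) ((transpose_mat H\<^sub>Z *\<^sub>v v) @\<^sub>v (transpose_mat F\<^sub>Z *\<^sub>v v)) \<psi>) = \<psi>}"

text \<open>\<open>Q\<close> is a code given by the EA-CSS construction from \<open>C\<^sub>X\<close> and \<open>C\<^sub>Z\<close>, for some choice of
  parity-check matrices and of a rank factorization.\<close>

definition ea_css_code ::
  "nat \<Rightarrow> nat \<Rightarrow> 'a::{field,finite} vec set \<Rightarrow> 'a vec set \<Rightarrow> ('a vec \<Rightarrow> complex) set \<Rightarrow> bool" where
  "ea_css_code n c C\<^sub>X C\<^sub>Z Q \<longleftrightarrow>
     (\<exists>H\<^sub>X H\<^sub>Z F\<^sub>X F\<^sub>Z.
        parity_check n C\<^sub>X H\<^sub>X \<and> parity_check n C\<^sub>Z H\<^sub>Z \<and>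
        c = vec_space.rank (dim_row H\<^sub>X) (H\<^sub>X * transpose_mat H\<^sub>Z) \<and>
        F\<^sub>X \<in> carrier_mat (dim_row H\<^sub>X) c \<and> F\<^sub>Z \<in> carrier_mat (dim_row H\<^sub>Z) c \<and>
        - (H\<^sub>X * transpose_mat H\<^sub>Z) = F\<^sub>X * transpose_mat F\<^sub>Z \<and>
        Q = stabilized_space n c H\<^sub>X H\<^sub>Z F\<^sub>X F\<^sub>Z)"

definition ea_css_distance :: "nat \<Rightarrow> 'a::field vec set \<Rightarrow> 'a vec set \<Rightarrow> enat" where
  "ea_css_distance n C\<^sub>X C\<^sub>Z =
     (if C\<^sub>X \<subseteq> dual_code n C\<^sub>Z then min (min_wt C\<^sub>X) (min_wt C\<^sub>Z)
      else min (min_wt (C\<^sub>X - (C\<^sub>X \<inter> dual_code n C\<^sub>Z))) (min_wt (C\<^sub>Z - (dual_code n C\<^sub>X \<inter> C\<^sub>Z))))"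

text \<open>The equation for \<open>c\<close> is the first of its two expressions; the other one,
  \<open>n - dim C\<^sub>Z - dim (C\<^sub>X \<inter> dual C\<^sub>Z)\<close>, has the same value. The equation for \<open>\<delta>\<close> forces it to be
  finite, so \<open>C\<^sub>X\<close> and \<open>C\<^sub>Z\<close> are not both zero.\<close>

definition css_like_EAQLRC ::
  "nat \<Rightarrow> nat \<Rightarrow> nat \<Rightarrow> nat \<Rightarrow> nat \<Rightarrow> ('a::{field,finite} vec \<Rightarrow> complex) set \<Rightarrow> bool" where
  "css_like_EAQLRC n \<kappa> \<delta> c r Q \<longleftrightarrow>
     (\<exists>C\<^sub>X C\<^sub>Z.
        linear_code n C\<^sub>X \<and> linear_code n C\<^sub>Z \<and> paired_support n r C\<^sub>X C\<^sub>Z \<and>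
        ea_css_code n c C\<^sub>X C\<^sub>Z Q \<and>
        int c = int n - int (code_dim n C\<^sub>X) - int (code_dim n (dual_code n C\<^sub>X \<inter> C\<^sub>Z)) \<and>
        int \<kappa> = int (code_dim n C\<^sub>X) + int (code_dim n C\<^sub>Z) - int n + int c \<and>
        enat \<delta> = ea_css_distance n C\<^sub>X C\<^sub>Z)"

end

theory Submission
  imports Defs
begin

text \<open>Put \<open>B = C\<^sub>X \<inter> C\<^sub>Z\<^sup>\<bottom>\<close>; then \<open>\<kappa> = k\<^sub>X - dim B\<close>. Imposing zeros on at most \<open>dim B\<close> coordinates
  leaves no nonzero word of \<open>B\<close> and a subcode of \<open>C\<^sub>X\<close> of dimension at least \<open>\<kappa>\<close>. On this subcode
  the usual greedy argument for locally recoverable codes applies: each of \<open>\<lceil>\<kappa> / r\<rceil> - 1\<close> recovery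
  sets yields one more zero than the dimension it costs. The remaining zeros are imposed one by one,
  as long as a nonzero word survives, and this word lies outside \<open>B\<close>. So
  \<open>wt (C\<^sub>X - B) \<le> n - k\<^sub>X - \<lceil>\<kappa> / r\<rceil> + 2\<close>; the same holds for \<open>C\<^sub>Z\<close>, and the two bounds are added.
  Dimensions enter through cardinalities, \<open>card C = q ^ dim C\<close>.\<close>

section \<open>Linear codes and their cardinalities\<close>

lemma linear_codeD:
  fixes C :: "'a::field vec set"
  assumes "linear_code n C"
  shows "C \<subseteq> carrier_vec n" "0\<^sub>v n \<in> C" "\<And>u v. u \<in> C \<Longrightarrow> v \<in> C \<Longrightarrow> u + v \<in> C"
    "\<And>a u. u \<in> C \<Longrightarrow> a \<cdot>\<^sub>v u \<in> C"
proof -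
  have *: "submodule class_ring C (module_vec TYPE('a) n)"
    using assms unfolding linear_code_def VectorSpace.subspace_def by blast
  show "C \<subseteq> carrier_vec n" "0\<^sub>v n \<in> C" "\<And>u v. u \<in> C \<Longrightarrow> v \<in> C \<Longrightarrow> u + v \<in> C"
    "\<And>a u. u \<in> C \<Longrightarrow> a \<cdot>\<^sub>v u \<in> C"
    using submodule.subset[OF *] submodule.zero_closed[OF *] submodule.m_closed[OF *]
      submodule.smult_closed[OF *] by (auto simp: module_vec_simps)
qed

lemma linear_codeI:
  fixes C :: "'a::field vec set"
  assumes "C \<subseteq> carrier_vec n" "0\<^sub>v n \<in> C" "\<And>u v. u \<in> C \<Longrightarrow> v \<in> C \<Longrightarrow> u + v \<in> C"
    "\<And>a u. u \<in> C \<Longrightarrow> a \<cdot>\<^sub>v u \<in> C"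
  shows "linear_code n C"
  unfolding linear_code_def VectorSpace.subspace_def submodule_def
  using assms vec_vs vec_module by (auto simp: module_vec_simps)

lemma linear_code_0: "linear_code n {0\<^sub>v n :: 'a::field vec}"
  by (rule linear_codeI) auto

lemma linear_code_dual: "C \<subseteq> carrier_vec n \<Longrightarrow> linear_code n (dual_code n (C :: 'a::field vec set))"
  by (rule linear_codeI)
    (auto simp: dual_code_def subset_iff add_scalar_prod_distrib[of _ n] smult_scalar_prod_distrib[of _ n])

lemma linear_code_Int: "linear_code n C \<Longrightarrow> linear_code n D \<Longrightarrow> linear_code n (C \<inter> D)"
  by (rule linear_codeI) (auto dest: linear_codeD)

lemma finite_carrier_vec: "finite (carrier_vec n :: 'a::finite vec set)"
proof (rule finite_subset)
  show "(carrier_vec n :: 'a vec set) \<subseteq> vec n ` ({..<n} \<rightarrow>\<^sub>E UNIV)"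
  proof
    fix v :: "'a vec" assume "v \<in> carrier_vec n"
    then have "v = vec n (restrict (($) v) {..<n})" by (intro eq_vecI) auto
    then show "v \<in> vec n ` ({..<n} \<rightarrow>\<^sub>E UNIV)" 
      by (rule image_eqI[where f = "vec n"]) auto
  qed
qed (intro finite_imageI finite_PiE, auto)

lemma finite_linear_code: "linear_code n C \<Longrightarrow> finite (C :: 'a::{field,finite} vec set)"
  using finite_carrier_vec finite_subset linear_codeD(1) by blast

text \<open>Coordinates with respect to a basis put \<open>C\<close> in bijection with the functions
  from that basis to the field. A finite basis exists because the finite set \<open>C\<close> spans
  itself.\<close>

lemma card_linear_code:
  fixes C :: "'a::{field,finite} vec set"
  assumes "linear_code n C"
  shows "card C = CARD('a) ^ code_dim n C"
proof -
  let ?V = "(module_vec TYPE('a) n)\<lparr>carrier := C\<rparr>"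
  interpret V: vectorspace class_ring ?V
    using vectorspace.subspace_is_vs[OF vec_vs] assms unfolding linear_code_def by blast
  have "V.fin_dim" unfolding V.fin_dim_def
  proof (intro exI conjI)
    show "finite (carrier ?V)" using finite_linear_code[OF assms] by simp
    show "V.span (carrier ?V) = carrier ?V"
      by (intro subset_antisym V.span_is_subset2 V.in_own_span subset_refl)
  qed simp
  then obtain A where A: "finite A" "V.basis A" using V.finite_basis_exists by blast
  then have AC: "A \<subseteq> carrier ?V" unfolding V.basis_def by blast
  define L where "L a = V.lincomb a A" for a
  \<comment> \<open>Restricting to extensional functions removes the freedom of coefficients off the
    basis, so each word has exactly one coefficient function.\<close>
  have unique: "\<exists>!a. a \<in> A \<rightarrow>\<^sub>E UNIV \<and> L a = v" if "v \<in> C" for v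
    using that A V.basis_criterion[OF A(1) AC] by (simp add: L_def)
  have closed: "L a \<in> C" for a
    using V.lincomb_closed[OF AC, of a] by (simp add: L_def)
  have "bij_betw L (A \<rightarrow>\<^sub>E UNIV) C"
    unfolding bij_betw_def
  proof
    show "inj_on L (A \<rightarrow>\<^sub>E UNIV)"
      using unique closed by (intro inj_onI) metis
    show "L ` (A \<rightarrow>\<^sub>E UNIV) = C"
    proof
      show "C \<subseteq> L ` (A \<rightarrow>\<^sub>E UNIV)"
        using unique by (metis imageI subsetI)
    qed (use closed in auto)
  qed
  then have "card C = card (A \<rightarrow>\<^sub>E (UNIV :: 'a set))" by (simp add: bij_betw_same_card)
  also have "\<dots> = CARD('a) ^ card A" using A by (simp add: card_PiE)
  also have "card A = code_dim n C" unfolding code_dim_def using V.dim_basis A by simp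
  finally show ?thesis .
qed

lemma card_field_gt_1: "CARD('a::{field,finite}) > 1"
proof -
  have "card {0, 1 :: 'a} \<le> CARD('a)" by (rule card_mono) auto
  then show ?thesis by simp
qed

lemma linear_code_eq_0:
  assumes "linear_code n (C :: 'a::{field,finite} vec set)" "card C \<le> 1"
  shows "C = {0\<^sub>v n}"
proof -
  have "u = 0\<^sub>v n" if "u \<in> C" for u
    using that assms linear_codeD(2) finite_linear_code by (metis One_nat_def card_le_Suc0_iff_eq)
  then show ?thesis using linear_codeD(2)[OF assms(1)] by blast
qed

text \<open>As \<open>f w\<close> is nonzero, the linear functional \<open>f\<close> takes every
  value on \<open>C\<close>, and its q fibres are translates of its kernel. Both coordinate maps and
  scalar products with a fixed word occur as \<open>f\<close>.\<close>

lemma card_kernel: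
  fixes C :: "'a::{field,finite} vec set"
  assumes C: "linear_code n C" and w: "w \<in> C" "f w \<noteq> 0"
    and add: "\<And>u v. u \<in> C \<Longrightarrow> v \<in> C \<Longrightarrow> f (u + v) = f u + f v"
    and smult: "\<And>a u. u \<in> C \<Longrightarrow> f (a \<cdot>\<^sub>v u) = a * f u"
  shows "card C = CARD('a) * card {u \<in> C. f u = 0}"
proof -
  let ?K = "{u \<in> C. f u = 0}"
  \<comment> \<open>A section of \<open>f\<close>: the multiple of \<open>w\<close> on which
    \<open>f\<close> has value \<open>a\<close>. Subtracting it moves a word into the
    kernel.\<close>
  define s where "s a = (a / f w) \<cdot>\<^sub>v w" for a
  have s: "s a \<in> C" "f (s a) = a" for a
    unfolding s_def using linear_codeD(4)[OF C w(1)] smult[OF w(1)] w by auto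
  have car: "u \<in> carrier_vec n" if "u \<in> C" for u using linear_codeD(1)[OF C] that by auto
  have cancel: "u + s a + - 1 \<cdot>\<^sub>v s a = u" if "u \<in> C" for u a
    using car[OF that] car[OF s(1)[of a]] by auto
  have "bij_betw (\<lambda>(a, u). u + s a) (UNIV \<times> ?K) C"
  proof (rule bij_betwI[where g = "\<lambda>u. (f u, u + (-1) \<cdot>\<^sub>v s (f u))"])
    show "(\<lambda>(a, u). u + s a) \<in> UNIV \<times> ?K \<rightarrow> C"
      using s linear_codeD(3)[OF C] by auto
    show "(\<lambda>u. (f u, u + (-1) \<cdot>\<^sub>v s (f u))) \<in> C \<rightarrow> UNIV \<times> ?K"
      using s linear_codeD(3,4)[OF C] by (auto simp: add smult)
    show "(case (f u, u + (-1) \<cdot>\<^sub>v s (f u)) of (a, u) \<Rightarrow> u + s a) = u" if "u \<in> C" for u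
      using car[OF that] car[OF s(1)[of "f u"]] by auto
    show "(\<lambda>u. (f u, u + (-1) \<cdot>\<^sub>v s (f u))) (case p of (a, u) \<Rightarrow> u + s a) = p"
      if "p \<in> UNIV \<times> ?K" for p
      using that by (auto simp: add s cancel)
  qed
  then have "card ((UNIV :: 'a set) \<times> ?K) = card C" by (rule bij_betw_same_card)
  then show ?thesis by (simp add: card_cartesian_product)
qed

section \<open>Shortened codes\<close>

text \<open>The shortened code, with the positions in \<open>S\<close> kept as zeros instead of
  deleted, so that the length stays fixed and words can still be compared with other codes.\<close>

definition shorten :: "nat set \<Rightarrow> 'a::zero vec set \<Rightarrow> 'a vec set" where
  "shorten S C = {u \<in> C. \<forall>i\<in>S. u $ i = 0}"

lemma shorten_Un: "shorten (S \<union> T) C = shorten T (shorten S C)"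
  by (auto simp: shorten_def)

lemma shorten_insert: "shorten (insert i S) C = {u \<in> shorten S C. u $ i = 0}"
  by (auto simp: shorten_def)

lemma linear_code_shorten:
  assumes "linear_code n C" "S \<subseteq> {..<n}"
  shows "linear_code n (shorten S C)"
proof (rule linear_codeI)
  show "shorten S C \<subseteq> carrier_vec n"
    using linear_codeD(1)[OF assms(1)] by (auto simp: shorten_def)
  show "0\<^sub>v n \<in> shorten S C"
    using linear_codeD(2)[OF assms(1)] assms(2) by (auto simp: shorten_def)
  fix u assume u: "u \<in> shorten S C"
  then have u': "u \<in> C" "u \<in> carrier_vec n"
    using linear_codeD(1)[OF assms(1)] by (auto simp: shorten_def)
  show "a \<cdot>\<^sub>v u \<in> shorten S C" for a
    using u u' assms linear_codeD(4)[OF assms(1)] by (auto simp: shorten_def)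
  fix v assume v: "v \<in> shorten S C"
  then have v': "v \<in> C" "v \<in> carrier_vec n"
    using linear_codeD(1)[OF assms(1)] by (auto simp: shorten_def)
  show "u + v \<in> shorten S C"
    using u u' v v' assms linear_codeD(3)[OF assms(1)] by (auto simp: shorten_def)
qed

lemma card_shorten_insert:
  fixes C :: "'a::{field,finite} vec set"
  assumes C: "linear_code n C" and S: "S \<subseteq> {..<n}" and i: "i < n"
    and w: "w \<in> shorten S C" "w $ i \<noteq> 0"
  shows "card (shorten S C) = CARD('a) * card (shorten (insert i S) C)"
proof -
  note D = linear_code_shorten[OF C S]
  have dim: "dim_vec u = n" if "u \<in> shorten S C" for u
    using linear_codeD(1)[OF D] that by auto
  show ?thesis unfolding shorten_insert
    by (rule card_kernel[where f = "\<lambda>u. u $ i", OF D w]) (auto simp: dim i)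
qed

text \<open>Each imposed zero divides the cardinality by q or leaves it unchanged.\<close>

lemma card_shorten_ge:
  fixes C :: "'a::{field,finite} vec set"
  assumes C: "linear_code n C" and U: "U \<subseteq> {..<n}"
  shows "card C \<le> CARD('a) ^ card U * card (shorten U C)"
proof -
  have "finite U" using U finite_subset by blast
  then show ?thesis using U
  proof (induction U)
    case empty
    then show ?case by (simp add: shorten_def)
  next
    case (insert i U)
    have step: "card (shorten U C) \<le> CARD('a) * card (shorten (insert i U) C)"
    proof (cases "\<exists>w \<in> shorten U C. w $ i \<noteq> 0")
      case True
      then show ?thesis using card_shorten_insert[OF C] insert.prems by auto
    next
      case False
      then have "shorten (insert i U) C = shorten U C" by (auto simp: shorten_insert)
      then show ?thesis by simp
    qed
    have "card C \<le> CARD('a) ^ card U * card (shorten U C)" using insert by auto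
    also have "\<dots> \<le> CARD('a) ^ card U * (CARD('a) * card (shorten (insert i U) C))"
      using step by (rule mult_le_mono2)
    finally show ?case using insert.hyps by (simp add: mult_ac)
  qed
qed

lemma nonzero_coordinate:
  assumes C: "linear_code n (C :: 'a::{field,finite} vec set)" and "card C > 1"
  obtains u i where "u \<in> C" "i < n" "u $ i \<noteq> 0"
proof -
  have "C \<noteq> {0\<^sub>v n}" using assms by auto
  then obtain u where "u \<in> C" "u \<noteq> 0\<^sub>v n" using linear_codeD(2)[OF C] by auto
  moreover from this have "u \<in> carrier_vec n" using linear_codeD(1)[OF C] by auto
  ultimately show thesis using that
    by (metis carrier_vecD eq_vecI index_zero_vec)
qed

text \<open>As long as a nonzero word survives, a zero imposed at one of its nonzero coordinates
  divides the cardinality by exactly q, so \<open>b\<close> such choices exhaust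
  \<open>B\<close>.\<close>

lemma trivial_shortening:
  assumes "linear_code n (B :: 'a::{field,finite} vec set)" "card B \<le> CARD('a) ^ b"
  obtains J where "J \<subseteq> {..<n}" "card J \<le> b" "shorten J B = {0\<^sub>v n}"
proof -
  have "\<exists>J \<subseteq> {..<n}. card J \<le> b \<and> shorten J B = {0\<^sub>v n}"
    using assms
  proof (induction b arbitrary: B)
    case 0
    then show ?case using linear_code_eq_0[of n B]
      by (intro exI[of _ "{}"]) (auto simp: shorten_def)
  next
    case (Suc b)
    show ?case
    proof (cases "card B > 1")
      case False
      then show ?thesis using linear_code_eq_0[OF Suc.prems(1)]
        by (intro exI[of _ "{}"]) (auto simp: shorten_def)
    next
      case True
      then obtain u i where u: "u \<in> B" "i < n" "u $ i \<noteq> 0"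
        using nonzero_coordinate Suc.prems(1) by blast
      have "card B = CARD('a) * card (shorten {i} B)"
        using card_shorten_insert[OF Suc.prems(1), of "{}" i u] u by (auto simp: shorten_def)
      then have "card (shorten {i} B) \<le> CARD('a) ^ b" using Suc.prems(2) by simp
      with Suc.IH[OF linear_code_shorten[OF Suc.prems(1)], of "{i}"] u obtain J where
        J: "J \<subseteq> {..<n}" "card J \<le> b" "shorten J (shorten {i} B) = {0\<^sub>v n}" by auto
      have "card (insert i J) \<le> Suc b" 
        using J(2) finite_subset[OF J(1)] by (simp add: card_insert_if)
      then show ?thesis using J u shorten_Un[of "{i}" J B]
        by (intro exI[of _ "insert i J"]) auto
    qed
  qed
  then show thesis using that by blast
qed

text \<open>The inequality says that the zeros on \<open>S\<close> cost at most
  \<open>\<rho>\<close> dimensions out of \<open>k\<close>. Some dimension is left, hence a nonzero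
  word, and its nonzero coordinates are new positions.\<close>

lemma shorten_nontrivial:
  assumes "linear_code n (C :: 'a::{field,finite} vec set)" "S \<subseteq> {..<n}"
    and "CARD('a) ^ k \<le> CARD('a) ^ \<rho> * card (shorten S C)" "\<rho> < k"
  obtains u i where "u \<in> shorten S C" "i < n" "i \<notin> S" "u $ i \<noteq> 0"
proof -
  have "card (shorten S C) > 1"
  proof (rule ccontr)
    assume "\<not> ?thesis"
    then have "CARD('a) ^ k \<le> CARD('a) ^ \<rho> * 1"
      using assms(3) by (meson le_trans mult_le_mono2 not_less)
    moreover have "CARD('a) ^ \<rho> < CARD('a) ^ k"
      using assms(4) card_field_gt_1 by (rule power_strict_increasing)
    ultimately show False by simp
  qed
  then obtain u i where "u \<in> shorten S C" "i < n" "u $ i \<noteq> 0"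
    using nonzero_coordinate linear_code_shorten assms(1,2) by blast
  moreover from this have "i \<notin> S" by (auto simp: shorten_def)
  ultimately show thesis using that by blast
qed

section \<open>Recovery sets and the greedy choice of zeros\<close>

text \<open>Classical locality of a single code: each coordinate is a linear combination of at most
  \<open>r\<close> others.\<close>

definition locality :: "nat \<Rightarrow> nat \<Rightarrow> 'a::field vec set \<Rightarrow> bool" where
  "locality n r C \<longleftrightarrow> (\<forall>i<n. \<exists>h \<in> dual_code n C. i \<in> supp h \<and> card (supp h) \<le> r + 1)"

text \<open>A coordinate of the support of a dual word \<open>h\<close> is zero as soon as all the others are, so
  imposing zeros on \<open>supp h\<close> gains one position over the dimension that it costs.\<close>

lemma shorten_recovery_set:
  fixes C :: "'a::{field,finite} vec set"
  assumes C: "linear_code n C" and h: "h \<in> dual_code n C" "i \<in> supp h"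
    and S: "supp h - {i} \<subseteq> S"
  shows "shorten (insert i S) C = shorten S C"
proof -
  have "u $ i = 0" if u: "u \<in> shorten S C" for u
  proof -
    have uC: "u \<in> C" "u \<in> carrier_vec n" using u linear_codeD(1)[OF C] by (auto simp: shorten_def)
    have hn: "h \<in> carrier_vec n" using h by (auto simp: dual_code_def)
    have i: "i < n" "h $ i \<noteq> 0" using h(2) hn by (auto simp: supp_def)
    have "h $ j * u $ j = 0" if "j < n" "j \<noteq> i" for j
      using that u S hn by (cases "h $ j = 0") (auto simp: supp_def shorten_def)
    then have "h \<bullet> u = (\<Sum>j\<in>{i}. h $ j * u $ j)"
      unfolding scalar_prod_def using i uC(2) by (intro sum.mono_neutral_right) auto
    moreover have "h \<bullet> u = 0" using h(1) uC(1) by (auto simp: dual_code_def)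
    ultimately show ?thesis using i by simp
  qed
  then show ?thesis by (auto simp: shorten_insert)
qed

text \<open>Induction on the number \<open>t\<close> of recovery sets used. The dimension spent is
  at most \<open>\<rho>\<close>, and the number of zeros exceeds \<open>\<rho>\<close> by at least
  \<open>t\<close>. The zeros on \<open>J\<close> are charged in full, and each recovery set then
  costs at most \<open>r\<close>.\<close>

lemma shorten_groups:
  fixes C :: "'a::{field,finite} vec set"
  assumes C: "linear_code n C" and cardC: "card C = CARD('a) ^ k"
    and loc: "locality n r C" and J: "J \<subseteq> {..<n}"
  shows "card J + t * r < k \<Longrightarrow> \<exists>S \<rho>. J \<subseteq> S \<and> S \<subseteq> {..<n} \<and> \<rho> + t \<le> card S \<and> \<rho> \<le> card J + t * r
    \<and> CARD('a) ^ k \<le> CARD('a) ^ \<rho> * card (shorten S C)"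
proof (induction t)
  case 0
  then show ?case using J card_shorten_ge[OF C J] cardC
    by (intro exI[of _ J] exI[of _ "card J"]) auto
next
  case (Suc t)
  then obtain S \<rho> where S: "J \<subseteq> S" "S \<subseteq> {..<n}" "\<rho> + t \<le> card S" "\<rho> \<le> card J + t * r"
    "CARD('a) ^ k \<le> CARD('a) ^ \<rho> * card (shorten S C)" by auto
  \<comment> \<open>The recovery set is taken at a position outside \<open>S\<close>, so that the
    zero gained for free is a new one.\<close>
  obtain u i where i: "i < n" "i \<notin> S"
    using shorten_nontrivial[OF C S(2) S(5)] S(4) Suc.prems by (auto simp: algebra_simps)
  obtain h where h: "h \<in> dual_code n C" "i \<in> supp h" "card (supp h) \<le> r + 1"
    using loc i(1) unfolding locality_def by blast
  have hn: "supp h \<subseteq> {..<n}" using h(1) by (auto simp: supp_def dual_code_def)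
  \<comment> \<open>Only the positions of the recovery set that are not yet zero are charged to
    \<open>\<rho>\<close>; the zero at \<open>i\<close> then comes for free.\<close>
  define U where "U = supp h - {i} - S"
  have fin: "finite (supp h)" "finite S" using hn S(2) finite_subset by blast+
  have Un: "U \<subseteq> {..<n}" "U \<inter> S = {}" "i \<notin> U" "finite U" using hn fin by (auto simp: U_def)
  have "card U \<le> card (supp h - {i})" using fin by (intro card_mono) (auto simp: U_def)
  then have Ur: "card U \<le> r" using h fin by simp
  have "shorten (insert i (S \<union> U)) C = shorten (S \<union> U) C"
    by (rule shorten_recovery_set[OF C h(1,2)]) (auto simp: U_def)
  moreover have "card (shorten S C) \<le> CARD('a) ^ card U * card (shorten (S \<union> U) C)"
    using card_shorten_ge[OF linear_code_shorten[OF C S(2)] Un(1)] by (simp add: shorten_Un)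
  ultimately have "CARD('a) ^ \<rho> * card (shorten S C)
      \<le> CARD('a) ^ (\<rho> + card U) * card (shorten (insert i (S \<union> U)) C)"
    by (simp add: power_add mult.assoc)
  moreover have "card (insert i (S \<union> U)) = Suc (card S + card U)"
    using i Un fin by (simp add: card_Un_disjoint Int_commute)
  ultimately show ?case using S Ur Un(1) i(1)
    by (intro exI[of _ "insert i (S \<union> U)"] exI[of _ "\<rho> + card U"]) auto
qed

text \<open>Zeros imposed one at a time, each at a nonzero coordinate of a surviving word, add one
  position and cost one dimension, so the surplus \<open>t\<close> is kept while the cost grows from
  \<open>\<rho>\<close> to \<open>m\<close>.\<close>

lemma shorten_extend:
  fixes C :: "'a::{field,finite} vec set"
  assumes C: "linear_code n C"
    and S: "S \<subseteq> {..<n}" "\<rho> + t \<le> card S" "CARD('a) ^ k \<le> CARD('a) ^ \<rho> * card (shorten S C)"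
    and "\<rho> \<le> m"
  shows "m < k \<Longrightarrow> \<exists>S'. S \<subseteq> S' \<and> S' \<subseteq> {..<n} \<and> m + t \<le> card S'
    \<and> CARD('a) ^ k \<le> CARD('a) ^ m * card (shorten S' C)"
  using \<open>\<rho> \<le> m\<close>
proof (induction m rule: dec_induct)
  case base
  then show ?case using S by blast
next
  case (step m)
  then obtain S' where S': "S \<subseteq> S'" "S' \<subseteq> {..<n}" "m + t \<le> card S'"
    "CARD('a) ^ k \<le> CARD('a) ^ m * card (shorten S' C)" by auto
  obtain u i where u: "u \<in> shorten S' C" "i < n" "i \<notin> S'" "u $ i \<noteq> 0"
    using shorten_nontrivial[OF C S'(2,4)] step.prems by auto
  have "finite S'" using S'(2) finite_subset by blast
  then show ?case using S' u card_shorten_insert[OF C S'(2) u(2,1,4)]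
    by (intro exI[of _ "insert i S'"]) (auto simp: algebra_simps)
qed

text \<open>Since \<open>J\<close> kills \<open>B\<close>, every nonzero word of \<open>C\<close>
  vanishing on a set containing \<open>J\<close> lies outside \<open>B\<close>. It remains to impose
  as many zeros as possible while keeping a nonzero word.\<close>

lemma relative_singleton_bound:
  fixes C B :: "'a::{field,finite} vec set"
  assumes C: "linear_code n C" and B: "linear_code n B" and loc: "locality n r C"
    and t: "code_dim n B + t * r < code_dim n C"
  obtains u where "u \<in> C" "u \<notin> B" "card (supp u) + code_dim n C + t \<le> n + 1"
proof -
  let ?k = "code_dim n C"
  obtain J where J: "J \<subseteq> {..<n}" "card J \<le> code_dim n B" "shorten J B = {0\<^sub>v n}"
    using trivial_shortening[OF B] card_linear_code[OF B] by (metis order_refl)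
  obtain S \<rho> where S: "J \<subseteq> S" "S \<subseteq> {..<n}" "\<rho> + t \<le> card S" "\<rho> \<le> card J + t * r"
    "CARD('a) ^ ?k \<le> CARD('a) ^ \<rho> * card (shorten S C)"
    using shorten_groups[OF C card_linear_code[OF C] loc J(1), of t] J(2) t by auto
  \<comment> \<open>A cost of \<open>?k - 1\<close> is the largest that still guarantees a nonzero
    word; with the surplus it gives at least \<open>?k - 1 + t\<close> zeros.\<close>
  have \<rho>: "\<rho> \<le> ?k - 1" and k: "?k - 1 < ?k" using S(4) J(2) t by linarith+
  obtain S' where S': "S \<subseteq> S'" "S' \<subseteq> {..<n}" "?k - 1 + t \<le> card S'"
    "CARD('a) ^ ?k \<le> CARD('a) ^ (?k - 1) * card (shorten S' C)"
    using shorten_extend[OF C S(2,3,5) \<rho> k] by blast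
  obtain u i where u: "u \<in> shorten S' C" "i < n" "u $ i \<noteq> 0"
    using shorten_nontrivial[OF C S'(2,4) k] by blast
  have "u \<notin> B"
  proof
    assume "u \<in> B"
    then have "u \<in> shorten J B" using u(1) S(1) S'(1) by (auto simp: shorten_def)
    then show False using J(3) u(2,3) by auto
  qed
  moreover have "u \<in> C" "supp u \<subseteq> {..<n} - S'"
    using u(1) linear_codeD(1)[OF C] by (auto simp: shorten_def supp_def)
  moreover have "card (supp u) \<le> n - card S'"
    using card_mono[OF _ \<open>supp u \<subseteq> _\<close>] S'(2) by (simp add: card_Diff_subset finite_subset)
  moreover have "card S' \<le> n" using card_mono[OF _ S'(2)] by simp
  ultimately show thesis using that[of u] S'(3) by linarith
qed

section \<open>Counting orthogonal pairs\<close>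

text \<open>For fixed \<open>u\<close> in \<open>C\<close>, the words of \<open>D\<close> orthogonal
  to \<open>u\<close> are all of \<open>D\<close> if \<open>u\<close> lies in the dual of
  \<open>D\<close>, and a fraction 1/q of \<open>D\<close> otherwise. The factor q clears this
  denominator.\<close>

lemma card_orthogonal_pairs:
  fixes C D :: "'a::{field,finite} vec set"
  assumes C: "linear_code n C" and D: "linear_code n D"
  shows "CARD('a) * card {(u, v). u \<in> C \<and> v \<in> D \<and> u \<bullet> v = 0}
    = (card C + (CARD('a) - 1) * card (C \<inter> dual_code n D)) * card D"
proof -
  let ?q = "CARD('a)" and ?E = "C \<inter> dual_code n D"
  have Cn: "C \<subseteq> carrier_vec n" and Dn: "D \<subseteq> carrier_vec n"
    using linear_codeD(1) C D by blast+
  have fin: "finite C" "finite D" using finite_linear_code C D by blast+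
  obtain p where p: "?q = Suc p" using card_field_gt_1[where 'a = 'a] less_imp_Suc_add by blast
  have slice: "?q * card {v \<in> D. u \<bullet> v = 0} = (if u \<in> ?E then ?q else 1) * card D"
    if u: "u \<in> C" for u
  proof (cases "u \<in> ?E")
    case True
    then have "{v \<in> D. u \<bullet> v = 0} = D" by (auto simp: dual_code_def)
    then show ?thesis using True by simp
  next
    case False
    then obtain w where w: "w \<in> D" "u \<bullet> w \<noteq> 0" using u Cn by (auto simp: dual_code_def)
    have "card D = ?q * card {v \<in> D. u \<bullet> v = 0}"
      using u Cn Dn by (intro card_kernel[where w = w and f = "(\<bullet>) u", OF D w])
        (auto simp: subset_iff scalar_prod_add_distrib[of _ n])
    then show ?thesis using False u by auto
  qed
  have "{(u, v). u \<in> C \<and> v \<in> D \<and> u \<bullet> v = 0} = Sigma C (\<lambda>u. {v \<in> D. u \<bullet> v = 0})" by auto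
  then have "?q * card {(u, v). u \<in> C \<and> v \<in> D \<and> u \<bullet> v = 0}
      = (\<Sum>u\<in>C. ?q * card {v \<in> D. u \<bullet> v = 0})"
    using fin by (simp add: sum_distrib_left)
  \<comment> \<open>The weight q on \<open>?E\<close> is split as 1 + (q - 1), so that the sum
    separates into one over \<open>C\<close> and one over \<open>?E\<close>.\<close>
  also have "\<dots> = (\<Sum>u\<in>C. (1 + (if u \<in> ?E then ?q - 1 else 0)) * card D)"
  proof (rule sum.cong[OF refl])
    fix u assume u: "u \<in> C"
    show "?q * card {v \<in> D. u \<bullet> v = 0} = (1 + (if u \<in> ?E then ?q - 1 else 0)) * card D"
      unfolding slice[OF u] by (simp add: p)
  qed
  also have "\<dots> = (\<Sum>u\<in>C. 1 + (if u \<in> ?E then ?q - 1 else 0)) * card D"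
    by (rule sum_distrib_right[symmetric])
  also have "(\<Sum>u\<in>C. 1 + (if u \<in> ?E then ?q - 1 else 0)) = card C + (?q - 1) * card ?E"
    unfolding sum.distrib using fin by (simp add: sum.If_cases mult.commute)
  finally show ?thesis .
qed

text \<open>\<open>dim C - dim (C \<inter> D\<^sup>\<bottom>)\<close> and \<open>dim D - dim (D \<inter> C\<^sup>\<bottom>)\<close> are both the rank of the bilinear form
  between \<open>C\<close> and \<open>D\<close>; counting the orthogonal pairs in two ways avoids ranks.\<close>

lemma code_dim_Int_dual:
  fixes C D :: "'a::{field,finite} vec set"
  assumes C: "linear_code n C" and D: "linear_code n D"
  shows "code_dim n (C \<inter> dual_code n D) + code_dim n D = code_dim n (D \<inter> dual_code n C) + code_dim n C"
proof -
  let ?q = "CARD('a)"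
  have Cn: "C \<subseteq> carrier_vec n" and Dn: "D \<subseteq> carrier_vec n"
    using linear_codeD(1) C D by blast+
  have "{(v, u). v \<in> D \<and> u \<in> C \<and> v \<bullet> u = 0} = prod.swap ` {(u, v). u \<in> C \<and> v \<in> D \<and> u \<bullet> v = 0}"
    using Cn Dn by (force simp: image_iff comm_scalar_prod[of _ n])
  then have "card {(v, u). v \<in> D \<and> u \<in> C \<and> v \<bullet> u = 0} = card {(u, v). u \<in> C \<and> v \<in> D \<and> u \<bullet> v = 0}"
    by (simp add: card_image)
  then have "(card C + (?q - 1) * card (C \<inter> dual_code n D)) * card D
      = (card D + (?q - 1) * card (D \<inter> dual_code n C)) * card C"
    using card_orthogonal_pairs[OF C D] card_orthogonal_pairs[OF D C] by simp
  \<comment> \<open>The product of the cardinalities of \<open>C\<close> and \<open>D\<close> occurs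
    on both sides and cancels.\<close>
  then have "(?q - 1) * (card (C \<inter> dual_code n D) * card D) = (?q - 1) * (card (D \<inter> dual_code n C) * card C)"
    by (simp add: algebra_simps)
  then have "card (C \<inter> dual_code n D) * card D = card (D \<inter> dual_code n C) * card C"
    using card_field_gt_1[where 'a = 'a] by simp
  then have "?q ^ (code_dim n (C \<inter> dual_code n D) + code_dim n D)
      = ?q ^ (code_dim n (D \<inter> dual_code n C) + code_dim n C)"
    using C D Cn Dn by (simp add: power_add linear_code_Int linear_code_dual
        flip: card_linear_code[OF C] card_linear_code[OF D] card_linear_code[of n "_ \<inter> _"])
  then show ?thesis using card_field_gt_1[where 'a = 'a] power_inject_exp by blast
qed

section \<open>Minimum weights and the bound on the distance\<close>

lemma min_wt_le:
  assumes "u \<in> S" "u \<noteq> 0\<^sub>v (dim_vec u)"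
  shows "min_wt S \<le> enat (card (supp u))"
  unfolding min_wt_def using assms by (intro INF_lower) auto

lemma relative_min_wt_le:
  fixes C B :: "'a::{field,finite} vec set"
  assumes C: "linear_code n C" and B: "linear_code n B" and loc: "locality n r C"
    and "code_dim n B + t * r < code_dim n C" and "enat \<delta> \<le> min_wt (C - B)"
  shows "\<delta> + code_dim n C + t \<le> n + 1"
proof -
  obtain u where u: "u \<in> C" "u \<notin> B" "card (supp u) + code_dim n C + t \<le> n + 1"
    using relative_singleton_bound assms by blast
  \<comment> \<open>The zero word belongs to \<open>B\<close>, so a word outside \<open>B\<close> is
    nonzero and counts for \<open>min_wt\<close>.\<close>
  have "u \<noteq> 0\<^sub>v (dim_vec u)"
    using u(1,2) linear_codeD(1)[OF C] linear_codeD(2)[OF B] by auto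
  then have "enat \<delta> \<le> enat (card (supp u))"
    using assms(5) min_wt_le[of u "C - B"] u order_trans by blast
  then show ?thesis using u(3) by simp
qed

text \<open>The classical Singleton bound, obtained as the relative bound with zero \<open>B\<close>
  and \<open>t = 0\<close>.\<close>

lemma min_wt_le_singleton:
  fixes C :: "'a::{field,finite} vec set"
  assumes C: "linear_code n C" and loc: "locality n r C"
    and "code_dim n C > 0" and "enat \<delta> \<le> min_wt C"
  shows "\<delta> + code_dim n C \<le> n + 1"
proof -
  have "CARD('a) ^ code_dim n {0\<^sub>v n :: 'a vec} = 1"
    using card_linear_code[OF linear_code_0, where 'a = 'a] by simp
  then have "code_dim n {0\<^sub>v n :: 'a vec} = 0"
    using card_field_gt_1[where 'a = 'a] by (simp add: power_eq_1_iff)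
  moreover have "enat \<delta> \<le> min_wt (C - {0\<^sub>v n})"
    using assms(4) unfolding min_wt_def
    by (rule order_trans) (auto intro!: INF_superset_mono)
  ultimately show ?thesis
    using relative_min_wt_le[OF C linear_code_0 loc, of 0 \<delta>] assms(3) by simp
qed

text \<open>The infimum over the empty set is infinite. As \<open>\<delta>\<close> is finite, this
  excludes that both codes are zero.\<close>

lemma min_wt_code_dim_0:
  fixes C :: "'a::{field,finite} vec set"
  assumes "linear_code n C" "code_dim n C = 0"
  shows "min_wt C = \<infinity>"
proof -
  have "C = {0\<^sub>v n}" using assms card_linear_code[OF assms(1)] by (intro linear_code_eq_0) auto
  then have "{u \<in> C. u \<noteq> 0\<^sub>v (dim_vec u)} = {}" by auto
  then show ?thesis by (simp only: min_wt_def image_empty Inf_empty top_enat_def)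
qed

lemma paired_support_locality:
  assumes "paired_support n r C\<^sub>X C\<^sub>Z"
  shows "locality n r C\<^sub>X" "locality n r C\<^sub>Z"
proof -
  have fin: "finite (supp h)" for h :: "'a vec" by (auto simp: supp_def)
  have "card (supp h) \<le> r + 1" "card (supp h') \<le> r + 1"
    if "card (supp h \<union> supp h') \<le> r + 1" for h h' :: "'a vec"
    using that fin by (meson Un_upper1 Un_upper2 card_mono finite_UnI le_trans)+
  then show "locality n r C\<^sub>X" "locality n r C\<^sub>Z"
    using assms unfolding paired_support_def locality_def by (meson IntE)+
qed

theorem theorem4:
  fixes Q :: "('a::{field,finite} vec \<Rightarrow> complex) set"
    and n \<kappa> \<delta> c r :: nat
  assumes "r > 0"
    and "css_like_EAQLRC n \<kappa> \<delta> c r Q"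
  shows "2 * int \<delta> \<le> int n + int c - int \<kappa> - 2 * \<lceil>real \<kappa> / real r\<rceil> + 4"
proof -
  obtain C\<^sub>X C\<^sub>Z :: "'a vec set" where X: "linear_code n C\<^sub>X" and Z: "linear_code n C\<^sub>Z"
    and ps: "paired_support n r C\<^sub>X C\<^sub>Z"
    and c: "int c = int n - int (code_dim n C\<^sub>X) - int (code_dim n (dual_code n C\<^sub>X \<inter> C\<^sub>Z))"
    and \<kappa>: "int \<kappa> = int (code_dim n C\<^sub>X) + int (code_dim n C\<^sub>Z) - int n + int c"
    and \<delta>: "enat \<delta> = ea_css_distance n C\<^sub>X C\<^sub>Z"
    using assms(2) unfolding css_like_EAQLRC_def by blast
  note loc = paired_support_locality[OF ps]
  let ?k\<^sub>X = "code_dim n C\<^sub>X" and ?k\<^sub>Z = "code_dim n C\<^sub>Z"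
  let ?A = "dual_code n C\<^sub>X \<inter> C\<^sub>Z" and ?B = "C\<^sub>X \<inter> dual_code n C\<^sub>Z"
  have Xn: "C\<^sub>X \<subseteq> carrier_vec n" and Zn: "C\<^sub>Z \<subseteq> carrier_vec n"
    using linear_codeD(1) X Z by blast+
  have A: "linear_code n ?A" and B: "linear_code n ?B"
    using X Z Xn Zn by (auto intro: linear_code_Int linear_code_dual)
  \<comment> \<open>The equations for \<open>c\<close> and \<open>\<kappa>\<close> give the
    codimension of \<open>?A\<close> in \<open>C\<^sub>Z\<close> directly; that of \<open>?B\<close>
    in \<open>C\<^sub>X\<close> is the same because the bilinear form has one rank.\<close>
  have \<kappa>Z: "\<kappa> + code_dim n ?A = ?k\<^sub>Z" using c \<kappa> by linarith
  then have \<kappa>X: "\<kappa> + code_dim n ?B = ?k\<^sub>X"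
    using code_dim_Int_dual[OF X Z] by (simp add: Int_commute)
  have sum: "int n + int c - int \<kappa> = 2 * int n - int ?k\<^sub>X - int ?k\<^sub>Z" using \<kappa> by linarith
  show ?thesis
  proof (cases "C\<^sub>X \<subseteq> dual_code n C\<^sub>Z")
    \<comment> \<open>Here \<open>\<kappa>\<close> and the ceiling vanish. If both codes are
      nonzero, their Singleton bounds are added; if only one is, twice its bound suffices.\<close>
    case True
    then have "?B = C\<^sub>X" by blast
    then have "\<kappa> = 0" using \<kappa>X by simp
    have min: "enat \<delta> \<le> min_wt C\<^sub>X" "enat \<delta> \<le> min_wt C\<^sub>Z"
      using \<delta> True by (simp_all add: ea_css_distance_def)
    have "?k\<^sub>X > 0 \<or> ?k\<^sub>Z > 0"
    proof (rule ccontr)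
      assume "\<not> ?thesis"
      then have "min_wt C\<^sub>X = \<infinity>" "min_wt C\<^sub>Z = \<infinity>"
        using min_wt_code_dim_0 X Z by blast+
      then show False using \<delta> True by (simp add: ea_css_distance_def)
    qed
    moreover have "?k\<^sub>X > 0 \<Longrightarrow> \<delta> + ?k\<^sub>X \<le> n + 1" "?k\<^sub>Z > 0 \<Longrightarrow> \<delta> + ?k\<^sub>Z \<le> n + 1"
      using min_wt_le_singleton X Z loc min by blast+
    ultimately have "2 * int \<delta> \<le> 2 * int n - int ?k\<^sub>X - int ?k\<^sub>Z + 4" by linarith
    then show ?thesis using sum \<open>\<kappa> = 0\<close> by simp
  next
    case False
    then have "card ?B < card C\<^sub>X" using finite_linear_code[OF X] by (intro psubset_card_mono) auto
    then have "\<kappa> > 0" using \<kappa>X card_linear_code[OF X] card_linear_code[OF B] by (cases \<kappa>) auto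
    \<comment> \<open>This is \<open>\<lceil>\<kappa> / r\<rceil> - 1\<close>, the largest number of
      recovery sets with \<open>t * r < \<kappa>\<close>, as the relative bound requires. The
      ceiling exceeds \<open>t\<close> by one, so adding the two bounds turns the constant 2 into
      4.\<close>
    define t where "t = (\<kappa> - 1) div r"
    have tr: "t * r < \<kappa>"
      using \<open>\<kappa> > 0\<close> div_times_less_eq_dividend[of "\<kappa> - 1" r] unfolding t_def by linarith
    have "\<kappa> - 1 < Suc t * r" unfolding t_def using assms(1) by (metis dividend_less_div_times mult_Suc add.commute)
    then have "\<kappa> \<le> Suc t * r" by linarith
    then have "real \<kappa> \<le> (1 + real t) * real r"
      by (metis of_nat_Suc of_nat_le_iff of_nat_mult)
    then have "\<lceil>real \<kappa> / real r\<rceil> \<le> int t + 1"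
      using assms(1) by (simp add: ceiling_le_iff divide_le_eq add.commute)
    moreover have "enat \<delta> \<le> min_wt (C\<^sub>X - ?B)" "enat \<delta> \<le> min_wt (C\<^sub>Z - ?A)"
      using \<delta> False by (simp_all add: ea_css_distance_def)
    then have "\<delta> + ?k\<^sub>X + t \<le> n + 1" "\<delta> + ?k\<^sub>Z + t \<le> n + 1"
      using relative_min_wt_le[OF X B loc(1), of t \<delta>] relative_min_wt_le[OF Z A loc(2), of t \<delta>]
        \<kappa>X \<kappa>Z tr by linarith+
    ultimately show ?thesis using sum by linarith
  qed
qed

end
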